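(* Let $\{F_n\}_n$ be a sequence in $\Delta_+$ and $\{k_n\}_n$ a sequence of positive integers such that $k_1<k_2<\cdots$. If there exists $F\in\Delta_+$ such that $\overbrace{F_n\,\cup_\vee\cdots\cup_\vee\,F_n}^{k_n\text{ times}}\xrightarrow{w}F$ as $n\to\infty$, then $\overbrace{F_n\,\Box_\vee\cdots\Box_\vee\,F_n}^{k_n\text{ times}}\xrightarrow{w}\mathbf{B}_1^M(F)$ as $n\to\infty$.
   Context: $\Delta$ is the set of all (cumulative) distribution functions of probability measures on $\mathbb{R}$, and $\Delta_+=\{F\in\Delta: F(x)=0\text{ for all }x<0\}$ (an atom at $0$ is allowed). $F_n\xrightarrow{w}F$ denotes weak convergence: $F_n(x)\to F(x)$ at every continuity point $x$ of $F$. Write $(a)_+=\max\{a,0\}$. Free max-convolution: for $F,G\in\Delta$, $(F\,\Box_\vee\,G)(x)=(F(x)+G(x)-1)_+$. For real $t\ge1$, $F^{\Box_\vee t}(x)=(tF(x)-(t-1))_+$; for a positive integer $n$ this is the $n$-fold free max-convolution of $F$ with itself. Boolean max-convolution: for $x,y\in[0,1]$, $x\cup_\vee y$ is defined by $(x\cup_\vee y)^{-1}-1=(x^{-1}-1)+(y^{-1}-1)$ if $x,y>0$, and $x\cup_\vee y=0$ if $x=0$ or $y=0$. For $F,G\in\Delta_+$, $(F\cup_\vee G)(x)=F(x)\cup_\vee G(x)$. For real $t>0$ and $F\in\Delta_+$, $F^{\cup_\vee t}=\dfrac{F}{t-(t-1)F}$; for a positive integer $n$ this is the $n$-fold Boolean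 max-convolution of $F$ with itself. For $t\ge0$ the map $\mathbf{B}_t^M:\Delta_+\to\Delta_+$ is defined by $\mathbf{B}_t^M(F)=\left(F^{\Box_\vee(1+t)}\right)^{\cup_\vee\frac{1}{1+t}}$. *)

theory Defs
  imports "HOL-Probability.Probability"
begin

definition distr_funs :: "(real \<Rightarrow> real) set" where
  "distr_funs = {cdf M | M. real_distribution M}"

definition distr_funs_nonneg :: "(real \<Rightarrow> real) set" where
  "distr_funs_nonneg = {F \<in> distr_funs. \<forall>x<0. F x = 0}"

text \<open>
  The operations below are total functions on \<^typ>\<open>real \<Rightarrow> real\<close>; they are meaningful only on
  \<^const>\<open>distr_funs\<close> (free) and \<^const>\<open>distr_funs_nonneg\<close> (Boolean).
\<close>

definition free_max_conv :: "(real \<Rightarrow> real) \<Rightarrow> (real \<Rightarrow> real) \<Rightarrow> real \<Rightarrow> real" where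
  "free_max_conv F G = (\<lambda>x. max (F x + G x - 1) 0)"

definition free_max_pow :: "(real \<Rightarrow> real) \<Rightarrow> real \<Rightarrow> real \<Rightarrow> real" where
  "free_max_pow F t = (\<lambda>x. max (t * F x - (t - 1)) 0)"

text \<open>
  On \<open>[0, 1]\<close>, the operation is the \<open>z\<close> solving \<open>1/z - 1 = (1/x - 1) + (1/y - 1)\<close>.
\<close>

definition bool_max :: "real \<Rightarrow> real \<Rightarrow> real" where
  "bool_max x y =
     (if x = 0 \<or> y = 0 then 0 else inverse (1 + ((inverse x - 1) + (inverse y - 1))))"

lemma bool_max_characterization:
  assumes "x \<in> {0<..1}" "y \<in> {0<..1}"
  shows "bool_max x y \<in> {0<..1}"
    and "inverse (bool_max x y) - 1 = (inverse x - 1) + (inverse y - 1)"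
proof -
  have "inverse x \<ge> 1" "inverse y \<ge> 1"
    using assms by (auto simp: one_le_inverse)
  then have "1 + ((inverse x - 1) + (inverse y - 1)) \<ge> 1"
    by simp
  then show "bool_max x y \<in> {0<..1}"
    using assms by (auto simp: bool_max_def inverse_le_1_iff)
  show "inverse (bool_max x y) - 1 = (inverse x - 1) + (inverse y - 1)"
    using assms by (auto simp: bool_max_def)
qed

definition bool_max_conv :: "(real \<Rightarrow> real) \<Rightarrow> (real \<Rightarrow> real) \<Rightarrow> real \<Rightarrow> real" where
  "bool_max_conv F G = (\<lambda>x. bool_max (F x) (G x))"

definition bool_max_pow :: "(real \<Rightarrow> real) \<Rightarrow> real \<Rightarrow> real \<Rightarrow> real" where
  "bool_max_pow F t = (\<lambda>x. F x / (t - (t - 1) * F x))"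

text \<open>
  \<open>nfold op n F\<close> is \<open>F \<^bold>\<cdot> \<dots> \<^bold>\<cdot> F\<close> with \<open>n\<close> factors \<open>F\<close>, bracketed to the left, where
  \<open>\<^bold>\<cdot>\<close> is \<open>op\<close>. It is meant for \<open>n \<ge> 1\<close>; at \<open>n = 0\<close> truncated subtraction makes it \<open>F\<close>.
\<close>

definition nfold :: "('a \<Rightarrow> 'a \<Rightarrow> 'a) \<Rightarrow> nat \<Rightarrow> 'a \<Rightarrow> 'a" where
  "nfold op n F = ((\<lambda>G. op G F) ^^ (n - 1)) F"

definition BM :: "real \<Rightarrow> (real \<Rightarrow> real) \<Rightarrow> real \<Rightarrow> real" where
  "BM t F = bool_max_pow (free_max_pow F (1 + t)) (1 / (1 + t))"

end

theory Submission
  imports Defs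
begin

text \<open>
  Both \<open>k\<close>-fold convolutions act on the value \<open>a = F\<^sub>n x\<close> alone, so they can be compared at each
  point. The free one is \<open>(1 - s)\<^sub>+\<close> with \<open>s = k (1 - a)\<close>, the Boolean one is \<open>b = a / (a + s)\<close>.
  Eliminating \<open>a\<close> gives \<open>s = (1 - b) / (1/k + (1 - 1/k) b)\<close>, so if \<open>b \<rightarrow> c\<close> and \<open>k \<rightarrow> \<infinity>\<close> then
  \<open>s \<rightarrow> 1/c - 1\<close> (and \<open>s\<close> ends up above \<open>1\<close> if \<open>c = 0\<close>). Hence the free convolution tends to
  \<open>(2 - 1/c)\<^sub>+\<close>, which is the value of \<open>BM 1\<close> at \<open>c\<close>: this is
  \<open>tendsto_free_max_pow_if_tendsto_bool_max_pow\<close>.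

  This yields convergence at the continuity points of \<open>F\<close>. The function \<open>BM 1 F\<close> may have more
  of them, since \<open>c \<mapsto> (2 - 1/c)\<^sub>+\<close> (read as \<open>0\<close> at \<open>c = 0\<close>) vanishes on \<open>[0, 1/2]\<close> and so hides the jumps of \<open>F\<close>
  that end at or below \<open>1/2\<close>. At those points, monotonicity and the density of the continuity points
  of \<open>F\<close> give convergence: this is \<open>weak_conv_if_tendsto_on_dense\<close>.
\<close>

section \<open>Closed forms of the iterated convolutions\<close>

lemma nfold_Suc_Suc: "nfold op (Suc (Suc m)) F = op (nfold op (Suc m) F) F"
  by (simp add: nfold_def)

lemma nfold_1: "nfold op (Suc 0) F = F"
  by (simp add: nfold_def)

text \<open>
  Truncating at \<open>0\<close> after every convolution agrees with truncating once at the end because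
  \<open>F x - 1 \<le> 0\<close>: once the value is \<open>0\<close> it stays there.
\<close>

lemma nfold_free_max_conv:
  assumes "\<And>x. 0 \<le> F x" and "\<And>x. F x \<le> 1" and "n > 0"
  shows "nfold free_max_conv n F = free_max_pow F (real n)"
proof -
  have "nfold free_max_conv (Suc m) F = free_max_pow F (real (Suc m))" for m
  proof (induction m)
    case 0
    show ?case
      using assms(1) by (simp add: nfold_1 free_max_pow_def fun_eq_iff max_absorb1)
  next
    case (Suc m)
    show ?case
    proof
      fix x
      have "max (max (real (Suc m) * F x - (real (Suc m) - 1)) 0 + F x - 1) 0
            = max (real (Suc (Suc m)) * F x - (real (Suc (Suc m)) - 1)) 0"
        using assms(2)[of x] by (simp add: max_def algebra_simps)
      then show "nfold free_max_conv (Suc (Suc m)) F x = free_max_pow F (real (Suc (Suc m))) x"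
        by (simp only: nfold_Suc_Suc Suc.IH) (simp only: free_max_conv_def free_max_pow_def)
    qed
  qed
  then show ?thesis
    using assms(3) by (metis gr0_implies_Suc)
qed

lemma bool_max_pow_alt: "bool_max_pow F t x = F x / (1 + (t - 1) * (1 - F x))"
  by (simp add: bool_max_pow_def algebra_simps)

lemma nfold_bool_max_conv:
  assumes "\<And>x. F x \<le> 1" and "n > 0"
  shows "nfold bool_max_conv n F = bool_max_pow F (real n)"
proof -
  have "nfold bool_max_conv (Suc m) F = bool_max_pow F (real (Suc m))" for m
  proof (induction m)
    case 0
    show ?case
      by (simp add: nfold_1 bool_max_pow_def)
  next
    case (Suc m)
    show ?case
    proof
      fix x
      define a where "a = F x"
      define d where "d = 1 + real m * (1 - a)"
      have "d > 0"
        using assms(1)[of x] by (auto simp: d_def a_def intro: add_pos_nonneg)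
      have "bool_max (a / d) a = a / (d + (1 - a))"
        using \<open>d > 0\<close> by (simp add: bool_max_def diff_divide_distrib[symmetric]
            add_divide_distrib[symmetric] divide_simps)
      then show "nfold bool_max_conv (Suc (Suc m)) F x = bool_max_pow F (real (Suc (Suc m))) x"
        by (simp add: nfold_Suc_Suc Suc.IH bool_max_conv_def bool_max_pow_alt d_def a_def
            algebra_simps)
    qed
  qed
  then show ?thesis
    using assms(2) by (metis gr0_implies_Suc)
qed

section \<open>Convergence at a single point\<close>

text \<open>
  The first case covers \<open>F x = 0\<close>, where \<open>1 / F x\<close> would take the default value \<open>0\<close>.
\<close>

lemma BM_1:
  assumes "F x \<ge> 0"
  shows "BM 1 F x = (if F x \<le> 1/2 then 0 else 2 - 1 / F x)"
  using assms by (auto simp: BM_def bool_max_pow_def free_max_pow_def max_def field_simps)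

text \<open>
  The quotient on the right tends to \<open>1 / b - 1\<close> as \<open>t \<rightarrow> \<infinity>\<close> with \<open>b > 0\<close> fixed, whereas the
  left side refers to a value \<open>F x\<close> that drifts to \<open>1\<close> at rate \<open>1 / t\<close>.
\<close>

lemma free_max_pow_via_bool_max_pow:
  assumes "0 \<le> F x" "F x \<le> 1" "t \<ge> 1"
  defines "b \<equiv> bool_max_pow F t x"
  shows "b \<in> {0..1}"
    and "free_max_pow F t x = max (1 - (1 - b) / (1 / t + (1 - 1 / t) * b)) 0"
proof -
  define d where "d = 1 + (t - 1) * (1 - F x)"
  have d: "d \<ge> 1"
    using assms(2,3) by (simp add: d_def)
  have b: "b = F x / d"
    by (simp add: b_def d_def bool_max_pow_alt)
  show "b \<in> {0..1}"
    using assms(1,2) d by (simp add: b)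
  have num: "1 - b = t * (1 - F x) / d"
  proof -
    have "d - F x = t * (1 - F x)"
      by (simp add: d_def algebra_simps)
    then show ?thesis
      using d by (simp add: b diff_divide_distrib[symmetric] divide_simps)
  qed
  have "d + (t - 1) * F x = t"
    by (simp add: d_def algebra_simps)
  then have den: "1 / t + (1 - 1 / t) * b = 1 / d"
    using d assms(3) by (simp add: b field_simps)
  have "(1 - b) / (1 / t + (1 - 1 / t) * b) = t * (1 - F x)"
    unfolding num den using d by simp
  then have "1 - (1 - b) / (1 / t + (1 - 1 / t) * b) = t * F x - (t - 1)"
    by (simp add: algebra_simps)
  then show "free_max_pow F t x = max (1 - (1 - b) / (1 / t + (1 - 1 / t) * b)) 0"
    by (simp add: free_max_pow_def)
qed

lemma tendsto_free_max_pow_if_tendsto_bool_max_pow: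
  fixes F_seq :: "nat \<Rightarrow> real \<Rightarrow> real" and t :: "nat \<Rightarrow> real"
  assumes "\<And>n. 0 \<le> F_seq n x" "\<And>n. F_seq n x \<le> 1" "\<And>n. t n \<ge> 1"
    and t: "filterlim t at_top sequentially"
    and lim: "(\<lambda>n. bool_max_pow (F_seq n) (t n) x) \<longlonglongrightarrow> F x"
  shows "(\<lambda>n. free_max_pow (F_seq n) (t n) x) \<longlonglongrightarrow> BM 1 F x"
proof -
  define b where "b = (\<lambda>n. bool_max_pow (F_seq n) (t n) x)"
  have b01: "b n \<in> {0..1}"
    and free: "free_max_pow (F_seq n) (t n) x
               = max (1 - (1 - b n) / (1 / t n + (1 - 1 / t n) * b n)) 0" for n
    using free_max_pow_via_bool_max_pow[of "F_seq n" x "t n"] assms(1-3) by (simp_all add: b_def)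
  have b: "b \<longlonglongrightarrow> F x"
    using lim by (simp add: b_def)
  have "F x \<ge> 0"
    using LIMSEQ_le_const[OF b, of 0] b01 by auto
  have t': "(\<lambda>n. 1 / t n) \<longlonglongrightarrow> 0"
    using tendsto_inverse_0_at_top[OF t] by (simp add: inverse_eq_divide)
  show ?thesis
  proof (cases "F x = 0")
    case True
    \<comment> \<open>Once \<open>b n\<close> and \<open>1 / t n\<close> are below \<open>1/4\<close>, the quotient has numerator at least \<open>3/4\<close> and
      denominator at most \<open>1/2\<close>, so the truncation at \<open>0\<close> applies.\<close>
    have "\<forall>\<^sub>F n in sequentially. b n < 1/4"
      using order_tendstoD(2)[OF b, of "1/4"] True by simp
    moreover have "\<forall>\<^sub>F n in sequentially. 1 / t n < 1/4"
      using order_tendstoD(2)[OF t', of "1/4"] by simp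
    ultimately have "\<forall>\<^sub>F n in sequentially. free_max_pow (F_seq n) (t n) x = 0"
    proof eventually_elim
      case (elim n)
      have "1 / t n > 0" "1 / t n \<le> 1"
        using assms(3)[of n] by auto
      moreover have "(1 - 1 / t n) * b n \<le> 1 * b n" "0 \<le> (1 - 1 / t n) * b n"
        using b01[of n] calculation by (intro mult_right_mono mult_nonneg_nonneg; simp)+
      ultimately have "0 < 1 / t n + (1 - 1 / t n) * b n"
        and "1 / t n + (1 - 1 / t n) * b n \<le> 1 - b n"
        using elim by linarith+
      then show ?case
        by (simp add: free le_divide_eq)
    qed
    then show ?thesis
      using True by (simp add: BM_1 tendsto_eventually)
  next
    case False
    have "(\<lambda>n. max (1 - (1 - b n) / (1 / t n + (1 - 1 / t n) * b n)) 0)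
          \<longlonglongrightarrow> max (1 - (1 - F x) / (0 + (1 - 0) * F x)) 0"
      using False by (intro tendsto_intros b t') auto
    moreover have "max (1 - (1 - F x) / (0 + (1 - 0) * F x)) 0 = BM 1 F x"
      using False \<open>F x \<ge> 0\<close> by (simp add: BM_1 max_def field_simps)
    ultimately show ?thesis
      by (simp add: free)
  qed
qed

section \<open>Weak convergence from a dense set of points\<close>

text \<open>
  Next to a continuity point \<open>x\<close> of \<open>H\<close> there are points \<open>y < x < z\<close> of convergence with \<open>H y\<close>
  and \<open>H z\<close> close to \<open>H x\<close>, and \<open>H\<^sub>n x\<close> lies between \<open>H\<^sub>n y\<close> and \<open>H\<^sub>n z\<close>.
\<close>

lemma weak_conv_if_tendsto_on_dense:
  fixes H_seq :: "nat \<Rightarrow> real \<Rightarrow> real" and H :: "real \<Rightarrow> real"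
  assumes mono: "\<And>n. mono (H_seq n)"
    and dense: "\<And>u v. u < v \<Longrightarrow> \<exists>y\<in>D. u < y \<and> y < v"
    and lim: "\<And>y. y \<in> D \<Longrightarrow> (\<lambda>n. H_seq n y) \<longlonglongrightarrow> H y"
  shows "weak_conv H_seq H"
  unfolding weak_conv_def
proof (intro allI impI)
  fix x
  assume "isCont H x"
  then have tend: "(H \<longlongrightarrow> H x) (at x)"
    by (simp add: isCont_def)
  show "(\<lambda>n. H_seq n x) \<longlonglongrightarrow> H x"
  proof (rule order_tendstoI)
    fix l
    assume "l < H x"
    then have "eventually (\<lambda>y. l < H y) (at_left x)"
      using order_tendstoD(1)[OF tend] by (auto simp: eventually_at_split)
    then obtain u where "u < x" and u: "\<And>y. u < y \<Longrightarrow> y < x \<Longrightarrow> l < H y"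
      by (auto simp: eventually_at_left[of "x - 1"])
    obtain y where "y \<in> D" "u < y" "y < x"
      using dense[OF \<open>u < x\<close>] by auto
    then have "\<forall>\<^sub>F n in sequentially. l < H_seq n y"
      using order_tendstoD(1)[OF lim] u by auto
    then show "\<forall>\<^sub>F n in sequentially. l < H_seq n x"
      by eventually_elim (use monoD[OF mono, of y x] \<open>y < x\<close> in \<open>force intro: less_le_trans\<close>)
  next
    fix l
    assume "H x < l"
    then have "eventually (\<lambda>y. H y < l) (at_right x)"
      using order_tendstoD(2)[OF tend] by (auto simp: eventually_at_split)
    then obtain v where "x < v" and v: "\<And>z. x < z \<Longrightarrow> z < v \<Longrightarrow> H z < l"
      by (auto simp: eventually_at_right[of x "x + 1"])
    obtain z where "z \<in> D" "x < z" "z < v"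
      using dense[OF \<open>x < v\<close>] by auto
    then have "\<forall>\<^sub>F n in sequentially. H_seq n z < l"
      using order_tendstoD(2)[OF lim] v by auto
    then show "\<forall>\<^sub>F n in sequentially. H_seq n x < l"
      by eventually_elim (use monoD[OF mono, of x z] \<open>x < z\<close> in \<open>force intro: le_less_trans\<close>)
  qed
qed

lemma mono_isCont_dense:
  fixes F :: "real \<Rightarrow> real"
  assumes "mono F" "u < v"
  shows "\<exists>y\<in>{y. isCont F y}. u < y \<and> y < v"
proof -
  have "uncountable ({u<..<v} - {y. \<not> isCont F y})"
    using mono_ctble_discont[OF assms(1)] uncountable_open_interval[of u v] assms(2)
    by (simp add: uncountable_minus_countable)
  then have "{u<..<v} - {y. \<not> isCont F y} \<noteq> {}"
    by (metis countable_empty)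
  then show ?thesis
    by auto
qed

section \<open>The limit of the free convolutions\<close>

lemma distr_funs_nonneg_props:
  assumes "F \<in> distr_funs_nonneg"
  shows "mono F" "0 \<le> F x" "F x \<le> 1"
proof -
  obtain M where "real_distribution M" and F: "F = cdf M"
    using assms by (auto simp: distr_funs_nonneg_def distr_funs_def)
  then interpret real_distribution M
    by simp
  show "mono F"
    unfolding F by (intro monoI cdf_nondecreasing)
  show "0 \<le> F x" "F x \<le> 1"
    unfolding F by (simp_all add: cdf_nonneg cdf_bounded_prob)
qed

lemma mono_free_max_pow:
  assumes "mono F" "t \<ge> 0"
  shows "mono (free_max_pow F t)"
proof (rule monoI)
  fix x y :: real
  assume "x \<le> y"
  then have "t * F x \<le> t * F y"
    using assms by (intro mult_left_mono) (auto dest: monoD)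
  then show "free_max_pow F t x \<le> free_max_pow F t y"
    unfolding free_max_pow_def by (intro max.mono) auto
qed

theorem theorem1p2:
  fixes F_seq :: "nat \<Rightarrow> real \<Rightarrow> real" and k :: "nat \<Rightarrow> nat" and F :: "real \<Rightarrow> real"
  assumes "\<And>n. F_seq n \<in> distr_funs_nonneg"
    and "\<And>n. k n > 0"
    and "strict_mono k"
    and "F \<in> distr_funs_nonneg"
    and "weak_conv (\<lambda>n. nfold bool_max_conv (k n) (F_seq n)) F"
  shows "weak_conv (\<lambda>n. nfold free_max_conv (k n) (F_seq n)) (BM 1 F)"
proof -
  note props = distr_funs_nonneg_props[OF assms(1)]
  have free: "nfold free_max_conv (k n) (F_seq n) = free_max_pow (F_seq n) (real (k n))" for n
    by (rule nfold_free_max_conv) (rule props assms(2))+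
  have bool: "nfold bool_max_conv (k n) (F_seq n) = bool_max_pow (F_seq n) (real (k n))" for n
    by (rule nfold_bool_max_conv) (rule props assms(2))+
  have k: "filterlim (\<lambda>n. real (k n)) at_top sequentially"
    using filterlim_compose[OF filterlim_real_sequentially filterlim_subseq[OF assms(3)]] .
  have k1: "real (k n) \<ge> 1" for n
    using assms(2)[of n] by simp
  show ?thesis
    unfolding free
  proof (rule weak_conv_if_tendsto_on_dense[where D = "{y. isCont F y}"])
    show "mono (free_max_pow (F_seq n) (real (k n)))" for n
      by (intro mono_free_max_pow props) simp
    show "\<exists>y\<in>{y. isCont F y}. u < y \<and> y < v" if "u < v" for u v
      using mono_isCont_dense[OF distr_funs_nonneg_props(1)[OF assms(4)] that] .
    show "(\<lambda>n. free_max_pow (F_seq n) (real (k n)) y) \<longlonglongrightarrow> BM 1 F y"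
      if "y \<in> {y. isCont F y}" for y
      using assms(5) that
      by (intro tendsto_free_max_pow_if_tendsto_bool_max_pow props k k1)
         (simp add: weak_conv_def bool)
  qed
qed

end
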